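(* Let $f\in\mathcal F_{op}$. Let $n\ge 1$, let $A$ and $B$ be positive definite $n\times n$ complex matrices, and let $\rho$ be an $n\times n$ density matrix. Then $$\mathrm{E}_\rho\bigl(m_f(A,B)\bigr)\le m_f\bigl(\mathrm{E}_\rho(A),\mathrm{E}_\rho(B)\bigr).$$
   Context: A function $f\colon(0,\infty)\to\mathbb R$ is operator monotone (increasing) if $A\le B$ implies $f(A)\le f(B)$ for positive definite operators $A,B$ on an arbitrary Hilbert space, where $f(A)$ is defined by the functional calculus. $\mathcal F_{op}$ is the class of functions $f\colon(0,\infty)\to(0,\infty)$ such that: (1) $f$ is operator monotone increasing; (2) $t f(t^{-1})=f(t)$ for all $t>0$; (3) $f(1)=1$. For positive definite matrices $A,B$, the mean associated with $f$ is $m_f(A,B)=A^{1/2}f(A^{-1/2}BA^{-1/2})A^{1/2}$; for positive real numbers $a,b$ (the $1\times1$ case) this reads $m_f(a,b)=a f(a^{-1}b)$. A density matrix is a positive semi-definite matrix $\rho$ with $\operatorname{Tr}\rho=1$, and the expectation of a self-adjoint matrix $A$ in the state $\rho$ is $\mathrm{E}_\rho(A)=\operatorname{Tr}(\rho A)$. *)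

theory Defs
  imports
    "HOL-Analysis.Uniform_Limit"
    "HOL-Computational_Algebra.Polynomial"
    "HOL-Library.Function_Algebras"
    "HOL-Library.Infinite_Typeclass"
    "Jordan_Normal_Form.Schur_Decomposition"
begin

section \<open>Bounded operators on complex Hilbert spaces\<close>

text \<open>
  A Hilbert space is a complete inner product space whose underlying complex vector space is a
  subspace \<open>H\<close> of some complex vector space. Keeping \<open>H\<close> a set lets spaces of every dimension,
  finite or infinite, be quantified over inside one formula. The inner product is linear in its
  first argument, as \<open>v \<bullet>c w\<close> is. Neither the inner product nor an operator is constrained
  outside \<open>H\<close>.
\<close>

locale complex_inner_space = vector_space scale
  for scale :: "complex \<Rightarrow> 'v \<Rightarrow> 'v::ab_group_add" (infixr \<open>*s\<close> 75) +
  fixes H :: "'v set"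
    and ip :: "'v \<Rightarrow> 'v \<Rightarrow> complex"
  assumes subspace_H: "subspace H"
    and ip_add: "\<lbrakk>x \<in> H; y \<in> H; z \<in> H\<rbrakk> \<Longrightarrow> ip (x + y) z = ip x z + ip y z"
    and ip_scale: "\<lbrakk>x \<in> H; z \<in> H\<rbrakk> \<Longrightarrow> ip (c *s x) z = c * ip x z"
    and ip_cnj: "\<lbrakk>x \<in> H; y \<in> H\<rbrakk> \<Longrightarrow> ip y x = cnj (ip x y)"
    and ip_pos: "\<lbrakk>x \<in> H; x \<noteq> 0\<rbrakk> \<Longrightarrow> 0 < Re (ip x x)"
begin

definition hnorm :: "'v \<Rightarrow> real" where
  "hnorm x = sqrt (Re (ip x x))"

end

locale complex_hilbert_space = complex_inner_space scale H ip
  for scale :: "complex \<Rightarrow> 'v \<Rightarrow> 'v::ab_group_add" (infixr \<open>*s\<close> 75)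
    and H :: "'v set"
    and ip :: "'v \<Rightarrow> 'v \<Rightarrow> complex" +
  assumes complete_H:
    "\<And>X. \<lbrakk>\<And>n. X n \<in> H; \<And>e. e > 0 \<Longrightarrow> \<exists>N. \<forall>m\<ge>N. \<forall>n\<ge>N. hnorm (X m - X n) < e\<rbrakk>
       \<Longrightarrow> \<exists>L\<in>H. (\<lambda>n. hnorm (X n - L)) \<longlonglongrightarrow> 0"
begin

definition bounded_op :: "('v \<Rightarrow> 'v) \<Rightarrow> bool" where
  "bounded_op T \<longleftrightarrow>
     (\<forall>x\<in>H. T x \<in> H) \<and>
     (\<forall>x\<in>H. \<forall>y\<in>H. T (x + y) = T x + T y) \<and>
     (\<forall>c. \<forall>x\<in>H. T (c *s x) = c *s T x) \<and>
     (\<exists>K. \<forall>x\<in>H. hnorm (T x) \<le> K * hnorm x)"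

definition op_norm :: "('v \<Rightarrow> 'v) \<Rightarrow> real" where
  "op_norm T = (SUP x\<in>{x \<in> H. hnorm x \<le> 1}. hnorm (T x))"

definition invertible_op :: "('v \<Rightarrow> 'v) \<Rightarrow> bool" where
  "invertible_op T \<longleftrightarrow> (\<exists>S. bounded_op S \<and> (\<forall>x\<in>H. S (T x) = x \<and> T (S x) = x))"

definition op_spectrum :: "('v \<Rightarrow> 'v) \<Rightarrow> complex set" where
  "op_spectrum T = {z. \<not> invertible_op (\<lambda>x. T x - z *s x)}"

definition self_adjoint_op :: "('v \<Rightarrow> 'v) \<Rightarrow> bool" where
  "self_adjoint_op T \<longleftrightarrow> bounded_op T \<and> (\<forall>x\<in>H. \<forall>y\<in>H. ip (T x) y = ip x (T y))"

definition op_le :: "('v \<Rightarrow> 'v) \<Rightarrow> ('v \<Rightarrow> 'v) \<Rightarrow> bool" where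
  "op_le S T \<longleftrightarrow> (\<forall>x\<in>H. Re (ip (S x) x) \<le> Re (ip (T x) x))"

text \<open>
  Invertibility is part of positive definiteness: it puts the spectrum inside \<open>(0,\<infinity>)\<close>, the domain
  of the functions to be applied. In infinite dimension strict positivity of the quadratic form
  would not suffice for this.
\<close>

definition positive_definite_op :: "('v \<Rightarrow> 'v) \<Rightarrow> bool" where
  "positive_definite_op T \<longleftrightarrow>
     self_adjoint_op T \<and> (\<forall>x\<in>H. 0 \<le> Re (ip (T x) x)) \<and> invertible_op T"

definition poly_op :: "real poly \<Rightarrow> ('v \<Rightarrow> 'v) \<Rightarrow> 'v \<Rightarrow> 'v" where
  "poly_op p T x = (\<Sum>k\<le>degree p. complex_of_real (poly.coeff p k) *s (T ^^ k) x)"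

text \<open>
  \<open>functional_calculus f T F\<close> says that \<open>F = f(T)\<close> in the continuous functional calculus of the
  self-adjoint operator \<open>T\<close>: \<open>F\<close> is the norm limit of \<open>p\<^sub>n(T)\<close> for polynomials \<open>p\<^sub>n\<close> converging to
  \<open>f\<close> uniformly on the (real) spectrum of \<open>T\<close>. Such an \<open>F\<close> is unique on \<open>H\<close>, and it exists iff \<open>f\<close>
  is continuous on the spectrum; in finite dimension the spectrum is finite, so that \<open>f(T)\<close> exists
  for every \<open>f\<close>.
\<close>

definition functional_calculus :: "(real \<Rightarrow> real) \<Rightarrow> ('v \<Rightarrow> 'v) \<Rightarrow> ('v \<Rightarrow> 'v) \<Rightarrow> bool" where
  "functional_calculus f T F \<longleftrightarrow>
     bounded_op F \<and>
     (\<exists>p :: nat \<Rightarrow> real poly.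
        uniform_limit {t. complex_of_real t \<in> op_spectrum T} (\<lambda>n. poly (p n)) f sequentially \<and>
        (\<lambda>n. op_norm (\<lambda>x. poly_op (p n) T x - F x)) \<longlonglongrightarrow> 0)"

definition operator_monotone_here :: "(real \<Rightarrow> real) \<Rightarrow> bool" where
  "operator_monotone_here f \<longleftrightarrow>
     (\<forall>A B FA FB.
        positive_definite_op A \<and> positive_definite_op B \<and> op_le A B \<and>
        functional_calculus f A FA \<and> functional_calculus f B FB \<longrightarrow> op_le FA FB)"

end

section \<open>Operator monotone functions\<close>

text \<open>
  HOL cannot quantify over types inside a formula, so the ambient type \<open>'v\<close> of the Hilbert spaces is
  a parameter. With \<open>'v = 'i \<Rightarrow> complex\<close> (addition is pointwise) and \<open>'i\<close> infinite, the spaces ranged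
  over include, up to isomorphism, every Hilbert space with an orthonormal basis indexed by a subset
  of \<open>'i\<close>, in particular all finite-dimensional ones. No continuity of \<open>f\<close> is presupposed; the
  finite-dimensional spaces force it.
\<close>

definition operator_monotone :: "'v::ab_group_add itself \<Rightarrow> (real \<Rightarrow> real) \<Rightarrow> bool" where
  "operator_monotone _ f \<longleftrightarrow>
     (\<forall>(scale :: complex \<Rightarrow> 'v \<Rightarrow> 'v) H ip.
        complex_hilbert_space scale H ip \<longrightarrow>
        complex_hilbert_space.operator_monotone_here scale H ip f)"

definition F_op :: "'v::ab_group_add itself \<Rightarrow> (real \<Rightarrow> real) set" where
  "F_op U = {f.
     (\<forall>t>0. 0 < f t) \<and>
     operator_monotone U f \<and>
     (\<forall>t>0. t * f (inverse t) = f t) \<and>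
     f 1 = 1}"

section \<open>Matrices\<close>

definition hermitian_mat :: "nat \<Rightarrow> complex mat \<Rightarrow> bool" where
  "hermitian_mat n A \<longleftrightarrow> A \<in> carrier_mat n n \<and> mat_adjoint A = A"

definition positive_definite_mat :: "nat \<Rightarrow> complex mat \<Rightarrow> bool" where
  "positive_definite_mat n A \<longleftrightarrow>
     hermitian_mat n A \<and> (\<forall>v\<in>carrier_vec n. v \<noteq> 0\<^sub>v n \<longrightarrow> 0 < Re ((A *\<^sub>v v) \<bullet>c v))"

definition positive_semidefinite_mat :: "nat \<Rightarrow> complex mat \<Rightarrow> bool" where
  "positive_semidefinite_mat n A \<longleftrightarrow>
     hermitian_mat n A \<and> (\<forall>v\<in>carrier_vec n. 0 \<le> Re ((A *\<^sub>v v) \<bullet>c v))"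

definition mat_trace :: "complex mat \<Rightarrow> complex" where
  "mat_trace A = (\<Sum>i<dim_row A. A $$ (i, i))"

definition density_mat :: "nat \<Rightarrow> complex mat \<Rightarrow> bool" where
  "density_mat n \<rho> \<longleftrightarrow> positive_semidefinite_mat n \<rho> \<and> mat_trace \<rho> = 1"

text \<open>The trace is real for Hermitian \<open>\<rho>\<close> and \<open>A\<close>; \<open>Re\<close> only changes its type.\<close>

definition expectation :: "complex mat \<Rightarrow> complex mat \<Rightarrow> real" where
  "expectation \<rho> A = Re (mat_trace (\<rho> * A))"

definition unitary_mat :: "nat \<Rightarrow> complex mat \<Rightarrow> bool" where
  "unitary_mat n U \<longleftrightarrow>
     U \<in> carrier_mat n n \<and> U * mat_adjoint U = 1\<^sub>m n \<and> mat_adjoint U * U = 1\<^sub>m n"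

text \<open>
  \<open>f(A) = U diag(f(d\<^sub>0), \<dots>, f(d\<^sub>n\<^sub>-\<^sub>1)) U\<^sup>*\<close> for any unitary diagonalization
  \<open>A = U diag(d\<^sub>0, \<dots>, d\<^sub>n\<^sub>-\<^sub>1) U\<^sup>*\<close> of the Hermitian matrix \<open>A\<close>; the result does not depend on the
  diagonalization chosen.
\<close>

definition mat_fun :: "(real \<Rightarrow> real) \<Rightarrow> complex mat \<Rightarrow> complex mat" where
  "mat_fun f A = (THE M. \<exists>U d. unitary_mat (dim_row A) U \<and>
     A = U * mat_diag (dim_row A) (\<lambda>i. complex_of_real (d i)) * mat_adjoint U \<and>
     M = U * mat_diag (dim_row A) (\<lambda>i. complex_of_real (f (d i))) * mat_adjoint U)"

definition matrix_mean :: "(real \<Rightarrow> real) \<Rightarrow> complex mat \<Rightarrow> complex mat \<Rightarrow> complex mat" where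
  "matrix_mean f A B =
     (let R = mat_fun (\<lambda>t. t powr (1/2)) A;
          S = mat_fun (\<lambda>t. t powr (-1/2)) A
      in R * mat_fun f (S * B * S) * R)"

definition scalar_mean :: "(real \<Rightarrow> real) \<Rightarrow> real \<Rightarrow> real \<Rightarrow> real" where
  "scalar_mean f a b = a * f (inverse a * b)"

end

theory Submission
  imports Defs "HOL-Analysis.Convex"
begin

text \<open>
  A simultaneous congruence reduces the inequality to scalar concavity of \<open>f\<close>. Diagonalize
  \<open>A\<^sup>-\<^sup>1\<^sup>/\<^sup>2 B A\<^sup>-\<^sup>1\<^sup>/\<^sup>2 = V diag(e) V\<^sup>*\<close> and put \<open>P = A\<^sup>1\<^sup>/\<^sup>2 V\<close>. Then \<open>A = P P\<^sup>*\<close>, \<open>B = P diag(e) P\<^sup>*\<close> and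
  \<open>m\<^sub>f(A, B) = P diag(f(e)) P\<^sup>*\<close>, so the three expectations are \<open>\<Sum> w\<^sub>i\<close>, \<open>\<Sum> w\<^sub>i e\<^sub>i\<close> and
  \<open>\<Sum> w\<^sub>i f(e\<^sub>i)\<close> with the nonnegative weights \<open>w\<^sub>i = (P\<^sup>* \<rho> P)\<^sub>i\<^sub>i\<close>, and Jensen's inequality applies.

  Concavity of \<open>f\<close> already follows from operator monotonicity in dimension two: a rotation of
  \<open>diag(x, y)\<close> has a prescribed convex combination of \<open>x\<close> and \<open>y\<close> as its first diagonal entry
  and lies below a diagonal matrix whose first entry is only slightly larger.
\<close>

section \<open>Scalar concavity from monotonicity on a plane\<close>

locale coordinate_plane =
  fixes a b :: 'i
  assumes a_neq_b: "a \<noteq> b"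
begin

definition scale :: "complex \<Rightarrow> ('i \<Rightarrow> complex) \<Rightarrow> 'i \<Rightarrow> complex" where
  "scale c v = (\<lambda>i. c * v i)"

text \<open>A copy of C^2 inside the functions on \<open>'i\<close>, the ambient type over which the
  monotonicity hypothesis ranges. \<open>ip\<close> has to be definite on this subspace
  only.\<close>

definition H :: "('i \<Rightarrow> complex) set" where
  "H = {v. \<forall>i. i \<noteq> a \<longrightarrow> i \<noteq> b \<longrightarrow> v i = 0}"

definition ip :: "('i \<Rightarrow> complex) \<Rightarrow> ('i \<Rightarrow> complex) \<Rightarrow> complex" where
  "ip v w = v a * cnj (w a) + v b * cnj (w b)"

lemma H_eqI:
  assumes "v \<in> H" "w \<in> H" "v a = w a" "v b = w b"
  shows "v = w"
proof
  fix i
  show "v i = w i"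
    by (cases "i = a"; cases "i = b") (use assms in \<open>simp_all add: H_def\<close>)
qed

lemma Re_ip_self: "Re (ip v v) = (cmod (v a))\<^sup>2 + (cmod (v b))\<^sup>2"
  by (simp add: ip_def cmod_def power2_eq_square)

sublocale vector_space scale
  by standard (auto simp: scale_def algebra_simps fun_eq_iff)

sublocale complex_inner_space scale H ip
proof
  show "subspace H"
    unfolding subspace_def by (auto simp: H_def scale_def)
next
  fix x assume "x \<in> H" "x \<noteq> 0"
  then have "x a \<noteq> 0 \<or> x b \<noteq> 0"
    by (auto simp: H_def fun_eq_iff)
  then show "0 < Re (ip x x)"
    unfolding Re_ip_self by (auto simp: add_pos_nonneg add_nonneg_pos)
qed (auto simp: ip_def scale_def algebra_simps)

lemma hnorm_eq: "hnorm v = sqrt ((cmod (v a))\<^sup>2 + (cmod (v b))\<^sup>2)"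
  by (simp add: hnorm_def Re_ip_self)

lemma cmod_le_hnorm: "cmod (v a) \<le> hnorm v" "cmod (v b) \<le> hnorm v"
  by (auto simp: hnorm_eq intro: real_le_rsqrt)

lemma hnorm_le: "hnorm v \<le> cmod (v a) + cmod (v b)"
  by (simp add: hnorm_eq sqrt_sum_squares_le_sum)

text \<open>Completeness is inherited from the complex numbers: \<open>hnorm\<close> dominates both
  coordinates and is dominated by the sum of their moduli, so Cauchy sequences and limits can be
  treated coordinate by coordinate.\<close>

sublocale complex_hilbert_space scale H ip
proof
  fix X :: "nat \<Rightarrow> _"
  assume X: "\<And>n. X n \<in> H"
    and C: "\<And>e. e > 0 \<Longrightarrow> \<exists>N. \<forall>m\<ge>N. \<forall>n\<ge>N. hnorm (X m - X n) < e"
  have "Cauchy (\<lambda>n. X n i)" if i: "i = a \<or> i = b" for i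
  proof (rule metric_CauchyI)
    fix e :: real assume "e > 0"
    from C[OF this] obtain N where N: "\<forall>m\<ge>N. \<forall>n\<ge>N. hnorm (X m - X n) < e"
      by blast
    have "dist (X m i) (X n i) \<le> hnorm (X m - X n)" for m n
      using i cmod_le_hnorm[of "X m - X n"] by (auto simp: dist_norm)
    with N show "\<exists>N. \<forall>m\<ge>N. \<forall>n\<ge>N. dist (X m i) (X n i) < e"
      by (meson le_less_trans)
  qed
  from Cauchy_convergent[OF this[of a]] Cauchy_convergent[OF this[of b]]
  obtain la lb where la: "(\<lambda>n. X n a) \<longlonglongrightarrow> la" and lb: "(\<lambda>n. X n b) \<longlonglongrightarrow> lb"
    unfolding convergent_def by meson
  define L where "L = (\<lambda>i. if i = a then la else if i = b then lb else 0)"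
  have "L \<in> H" by (simp add: L_def H_def)
  moreover have "(\<lambda>n. hnorm (X n - L)) \<longlonglongrightarrow> 0"
  proof (rule tendsto_sandwich)
    show "\<forall>\<^sub>F n in sequentially. 0 \<le> hnorm (X n - L)"
      by (simp add: hnorm_eq)
    show "\<forall>\<^sub>F n in sequentially. hnorm (X n - L) \<le> cmod (X n a - la) + cmod (X n b - lb)"
      using hnorm_le[of "X _ - L"] a_neq_b by (auto simp: L_def)
    show "(\<lambda>n. cmod (X n a - la) + cmod (X n b - lb)) \<longlonglongrightarrow> 0"
      using tendsto_add[OF tendsto_norm_zero[OF LIM_zero[OF la]] tendsto_norm_zero[OF LIM_zero[OF lb]]]
      by simp
  qed simp
  ultimately show "\<exists>L\<in>H. (\<lambda>n. hnorm (X n - L)) \<longlonglongrightarrow> 0" by blast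
qed

section \<open>Operators with real symmetric matrix \<open>((p, c), (c, q))\<close>\<close>

definition sym_op :: "real \<Rightarrow> real \<Rightarrow> real \<Rightarrow> ('i \<Rightarrow> complex) \<Rightarrow> 'i \<Rightarrow> complex" where
  "sym_op p c q v = (\<lambda>i. if i = a then of_real p * v a + of_real c * v b
     else if i = b then of_real c * v a + of_real q * v b else 0)"

lemma sym_op_a [simp]: "sym_op p c q v a = of_real p * v a + of_real c * v b"
  and sym_op_b [simp]: "sym_op p c q v b = of_real c * v a + of_real q * v b"
  using a_neq_b by (simp_all add: sym_op_def)

lemma sym_op_in_H [simp]: "sym_op p c q v \<in> H"
  by (simp add: sym_op_def H_def)

text \<open>The sum of the moduli of the four matrix entries is a bound. The entries are complex
  because inverses of operators shifted by a complex \<open>z\<close> are treated as well.\<close>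

lemma bounded_op_intro:
  assumes "\<And>v. T v a = t1 * v a + t2 * v b" "\<And>v. T v b = t3 * v a + t4 * v b"
    and TH: "\<And>v. v \<in> H \<Longrightarrow> T v \<in> H"
  shows "bounded_op T"
  unfolding bounded_op_def
proof (intro conjI ballI allI)
  show "\<exists>K. \<forall>x\<in>H. hnorm (T x) \<le> K * hnorm x"
  proof (intro exI ballI)
    fix x
    have *: "cmod (s * x a + t * x b) \<le> (cmod s + cmod t) * hnorm x" for s t
    proof -
      have "cmod (s * x a + t * x b) \<le> cmod s * cmod (x a) + cmod t * cmod (x b)"
        by (metis norm_mult norm_triangle_ineq)
      also have "\<dots> \<le> cmod s * hnorm x + cmod t * hnorm x"
        by (intro add_mono mult_left_mono cmod_le_hnorm) auto
      finally show ?thesis by (simp add: algebra_simps)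
    qed
    show "hnorm (T x) \<le> (cmod t1 + cmod t2 + (cmod t3 + cmod t4)) * hnorm x"
      using hnorm_le[of "T x"] *[of t1 t2] *[of t3 t4] by (simp add: assms algebra_simps)
  qed
next
  fix x y assume xy: "x \<in> H" "y \<in> H"
  show "T (x + y) = T x + T y"
  proof (rule H_eqI)
    show "T (x + y) \<in> H" "T x + T y \<in> H"
      using xy by (auto intro: TH subspace_add[OF subspace_H])
  qed (simp_all add: assms algebra_simps)
next
  fix c x assume x: "x \<in> H"
  show "T (scale c x) = scale c (T x)"
  proof (rule H_eqI)
    show "T (scale c x) \<in> H" "scale c (T x) \<in> H"
      using x by (auto intro: TH subspace_scale[OF subspace_H])
  qed (simp_all add: assms scale_def algebra_simps)
qed (auto simp: TH)

lemma bounded_sym_op: "bounded_op (sym_op p c q)"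
  by (rule bounded_op_intro) auto

lemma self_adjoint_sym_op: "self_adjoint_op (sym_op p c q)"
  by (auto simp: self_adjoint_op_def bounded_sym_op ip_def algebra_simps)

lemma Re_ip_sym_op:
  "Re (ip (sym_op p c q v) v)
     = p * (cmod (v a))\<^sup>2 + 2 * c * Re (v a * cnj (v b)) + q * (cmod (v b))\<^sup>2"
  unfolding cmod_power2 by (simp add: ip_def power2_eq_square algebra_simps)

text \<open>Bound the cross term by moduli and multiply by \<open>p\<close>; completing the square
  then leaves a square plus the determinant times a square.\<close>

lemma Re_ip_sym_op_nonneg:
  assumes "0 < p" "c\<^sup>2 \<le> p * q"
  shows "0 \<le> Re (ip (sym_op p c q v) v)"
proof -
  let ?s = "cmod (v a)" and ?t = "cmod (v b)" and ?r = "Re (v a * cnj (v b))"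
  have r: "\<bar>?r\<bar> \<le> ?s * ?t"
    by (metis abs_Re_le_cmod complex_mod_cnj norm_mult)
  have "\<bar>c * ?r\<bar> \<le> \<bar>c\<bar> * (?s * ?t)"
    unfolding abs_mult using r by (intro mult_left_mono) auto
  then have "p * (p * ?s\<^sup>2 - 2 * \<bar>c\<bar> * (?s * ?t) + q * ?t\<^sup>2)
      \<le> p * (p * ?s\<^sup>2 + 2 * c * ?r + q * ?t\<^sup>2)"
    using assms by (intro mult_left_mono) auto
  moreover have "p * (p * ?s\<^sup>2 - 2 * \<bar>c\<bar> * (?s * ?t) + q * ?t\<^sup>2)
     = (p * ?s - \<bar>c\<bar> * ?t)\<^sup>2 + (p * q - c\<^sup>2) * ?t\<^sup>2"
    by (simp add: power2_eq_square algebra_simps)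
  moreover have "0 \<le> (p * ?s - \<bar>c\<bar> * ?t)\<^sup>2 + (p * q - c\<^sup>2) * ?t\<^sup>2"
    using assms by simp
  ultimately have "0 \<le> p * (p * ?s\<^sup>2 + 2 * c * ?r + q * ?t\<^sup>2)"
    by linarith
  then show ?thesis
    unfolding Re_ip_sym_op using assms by (simp add: zero_le_mult_iff)
qed

text \<open>The difference of two such operators is the one with the differences of the entries, so
  the order reduces to the determinant criterion.\<close>

lemma op_le_sym_op:
  assumes "p < p'" "(c' - c)\<^sup>2 \<le> (p' - p) * (q' - q)"
  shows "op_le (sym_op p c q) (sym_op p' c' q')"
  unfolding op_le_def
proof
  fix v
  have "0 \<le> Re (ip (sym_op (p' - p) (c' - c) (q' - q) v) v)"
    using assms by (intro Re_ip_sym_op_nonneg) auto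
  then show "Re (ip (sym_op p c q v) v) \<le> Re (ip (sym_op p' c' q' v) v)"
    unfolding Re_ip_sym_op by (simp add: algebra_simps)
qed

text \<open>By Cayley--Hamilton, \<open>(T - z) (T - (x + y - z)) = - (z - x) (z - y)\<close> for
  \<open>T = sym_op p c q\<close> with eigenvalues \<open>x\<close> and \<open>y\<close>.\<close>

lemma invertible_sym_op_minus:
  assumes xy: "p + q = x + y" "p * q - c\<^sup>2 = x * y" and z: "z \<noteq> of_real x" "z \<noteq> of_real y"
  shows "invertible_op (\<lambda>v. sym_op p c q v - scale z v)"
proof -
  define k where "k = - 1 / ((z - of_real x) * (z - of_real y))"
  define w where "w = of_real x + of_real y - z"
  define S where "S v = scale k (sym_op p c q v - scale w v)" for v
  have H1: "sym_op p c q v - scale u v \<in> H" if "v \<in> H" for u v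
    using that by (intro subspace_diff[OF subspace_H] subspace_scale[OF subspace_H]) auto
  have SH: "S v \<in> H" if "v \<in> H" for v
    unfolding S_def using that by (intro subspace_scale[OF subspace_H] H1)
  define P Q C where "P = complex_of_real p" and "Q = complex_of_real q" and "C = complex_of_real c"
  define X Y where "X = complex_of_real x" and "Y = complex_of_real y"
  note [simp] = P_def[symmetric] Q_def[symmetric] C_def[symmetric]
  have k: "k * ((z - X) * (z - Y)) = -1"
    using z by (simp add: k_def X_def Y_def)
  \<comment> \<open>The trace eliminates \<open>Y\<close> and the determinant eliminates
    \<open>C * C\<close>; the diagonal entries of the product then become polynomial identities, and
    the off-diagonal ones vanish.\<close>
  have "complex_of_real (x + y) = complex_of_real (p + q)" using xy by simp
  then have Y: "Y = P + Q - X" by (simp add: X_def Y_def algebra_simps)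
  have "complex_of_real (p * q - c\<^sup>2) = complex_of_real (x * y)" using xy by simp
  then have det: "C * C = P * Q - X * Y"
    by (simp add: power2_eq_square X_def Y_def algebra_simps)
  have w: "w = X + Y - z" by (simp add: w_def X_def Y_def)
  have "(P - z) * (P - w) + C * C = - ((z - X) * (z - Y))"
    "(Q - z) * (Q - w) + C * C = - ((z - X) * (z - Y))"
    unfolding det w Y by (simp_all add: algebra_simps)
  then have e1: "k * ((P - z) * (P - w) + C * C) = 1"
    and e2: "k * ((Q - z) * (Q - w) + C * C) = 1"
    using k by simp_all
  have e3: "(P - z) + (Q - w) = 0" and e4: "(P - w) + (Q - z) = 0"
    unfolding w Y by simp_all
  have "bounded_op S"
  proof (rule bounded_op_intro)
    show "S v a = (k * (P - w)) * v a + (k * C) * v b" for v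
      by (simp add: S_def scale_def algebra_simps)
    show "S v b = (k * C) * v a + (k * (Q - w)) * v b" for v
      by (simp add: S_def scale_def algebra_simps)
  qed (rule SH)
  moreover have "S (sym_op p c q v - scale z v) = v \<and> sym_op p c q (S v) - scale z (S v) = v"
    if v: "v \<in> H" for v
  proof (intro conjI H_eqI)
    have "S (sym_op p c q v - scale z v) a
        = k * (((P - z) * (P - w)) + C * C) * v a + k * C * ((P - w) + (Q - z)) * v b"
      by (simp add: S_def scale_def algebra_simps)
    then show "S (sym_op p c q v - scale z v) a = v a" unfolding e1 e4 by simp
    have "S (sym_op p c q v - scale z v) b
        = k * (((Q - z) * (Q - w)) + C * C) * v b + k * C * ((P - z) + (Q - w)) * v a"
      by (simp add: S_def scale_def algebra_simps)
    then show "S (sym_op p c q v - scale z v) b = v b" unfolding e2 e3 by simp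
    have "(sym_op p c q (S v) - scale z (S v)) a
        = k * (((P - z) * (P - w)) + C * C) * v a + k * C * ((P - z) + (Q - w)) * v b"
      by (simp add: S_def scale_def algebra_simps)
    then show "(sym_op p c q (S v) - scale z (S v)) a = v a" unfolding e1 e3 by simp
    have "(sym_op p c q (S v) - scale z (S v)) b
        = k * (((Q - z) * (Q - w)) + C * C) * v b + k * C * ((P - w) + (Q - z)) * v a"
      by (simp add: S_def scale_def algebra_simps)
    then show "(sym_op p c q (S v) - scale z (S v)) b = v b" unfolding e2 e4 by simp
  qed (auto intro: SH H1 v)
  ultimately show ?thesis unfolding invertible_op_def by blast
qed

text \<open>Invertibility is the shift by \<open>z = 0\<close>, which differs from both eigenvalues;
  nonnegativity of the form follows from the positive determinant \<open>x * y\<close>.\<close>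

lemma positive_definite_sym_op:
  assumes "p + q = x + y" "p * q - c\<^sup>2 = x * y" "0 < x" "0 < y" "0 < p"
  shows "positive_definite_op (sym_op p c q)"
proof -
  have "invertible_op (\<lambda>v. sym_op p c q v - scale 0 v)"
    using assms by (intro invertible_sym_op_minus[of p q x y]) auto
  moreover have "(\<lambda>v. sym_op p c q v - scale 0 v) = sym_op p c q"
    by (auto simp: fun_eq_iff scale_def)
  moreover have "c\<^sup>2 \<le> p * q" using assms mult_pos_pos[of x y] by linarith
  ultimately show ?thesis
    using assms by (auto simp: positive_definite_op_def self_adjoint_sym_op Re_ip_sym_op_nonneg)
qed

lemma poly_op_linear:
  assumes "v \<in> H"
  shows "poly_op [:\<alpha>, \<beta>:] (sym_op p c q) v = sym_op (\<alpha> + \<beta> * p) (\<beta> * c) (\<alpha> + \<beta> * q) v"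
proof -
  \<comment> \<open>The degree is \<open>0\<close> when \<beta> vanishes; padding the sum with zero
    coefficients up to index \<open>1\<close> treats both cases alike.\<close>
  have "poly_op [:\<alpha>, \<beta>:] (sym_op p c q) v
      = (\<Sum>k\<le>Suc 0. scale (of_real (poly.coeff [:\<alpha>, \<beta>:] k)) ((sym_op p c q ^^ k) v))"
    unfolding poly_op_def
    by (rule sum.mono_neutral_left) (simp_all add: coeff_eq_0)
  also have "\<dots> = scale (of_real \<alpha>) v + scale (of_real \<beta>) (sym_op p c q v)"
    by simp
  also have "\<dots> = sym_op (\<alpha> + \<beta> * p) (\<beta> * c) (\<alpha> + \<beta> * q) v"
  proof (rule H_eqI)
    show "scale (of_real \<alpha>) v + scale (of_real \<beta>) (sym_op p c q v) \<in> H"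
      by (intro subspace_add[OF subspace_H] subspace_scale[OF subspace_H] sym_op_in_H assms)
  qed (simp_all add: scale_def algebra_simps)
  finally show ?thesis .
qed

text \<open>The spectrum is contained in \<open>{x, y}\<close>, so the linear interpolation of \<open>f\<close> at \<open>x\<close> and \<open>y\<close>
  computes \<open>f(T)\<close> exactly.\<close>

lemma functional_calculus_sym_op:
  assumes xy: "p + q = x + y" "p * q - c\<^sup>2 = x * y"
    and fx: "f x = \<alpha> + \<beta> * x" and fy: "f y = \<alpha> + \<beta> * y"
  shows "functional_calculus f (sym_op p c q) (sym_op (\<alpha> + \<beta> * p) (\<beta> * c) (\<alpha> + \<beta> * q))"
proof -
  let ?T = "sym_op p c q" and ?F = "sym_op (\<alpha> + \<beta> * p) (\<beta> * c) (\<alpha> + \<beta> * q)"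
  have spec: "t = x \<or> t = y" if "complex_of_real t \<in> op_spectrum ?T" for t
  proof (rule ccontr)
    assume "\<not> (t = x \<or> t = y)"
    then have "invertible_op (\<lambda>v. ?T v - scale (of_real t) v)"
      by (intro invertible_sym_op_minus[OF xy]) simp_all
    with that show False by (simp add: op_spectrum_def)
  qed
  have "uniform_limit {t. complex_of_real t \<in> op_spectrum ?T} (\<lambda>n. poly [:\<alpha>, \<beta>:]) f sequentially"
  proof (rule uniform_limitI)
    fix e :: real assume "0 < e"
    moreover have "poly [:\<alpha>, \<beta>:] t = f t" if "complex_of_real t \<in> op_spectrum ?T" for t
      using spec[OF that] fx fy by (auto simp: mult.commute)
    ultimately show "\<forall>\<^sub>F n in sequentially. \<forall>t\<in>{t. complex_of_real t \<in> op_spectrum ?T}.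
        dist (poly [:\<alpha>, \<beta>:] t) (f t) < e"
      by simp
  qed
  moreover have "op_norm (\<lambda>v. poly_op [:\<alpha>, \<beta>:] ?T v - ?F v) = 0"
  proof -
    have "op_norm (\<lambda>v. poly_op [:\<alpha>, \<beta>:] ?T v - ?F v) = (SUP v\<in>{v \<in> H. hnorm v \<le> 1}. 0)"
      unfolding op_norm_def by (rule SUP_cong) (auto simp: poly_op_linear hnorm_eq)
    \<comment> \<open>The unit ball contains \<open>0\<close>, so the supremum is not over the empty
      set.\<close>
    also have "\<dots> = 0"
    proof (rule cSUP_const)
      have "0 \<in> {v \<in> H. hnorm v \<le> 1}" by (simp add: H_def hnorm_eq)
      then show "{v \<in> H. hnorm v \<le> 1} \<noteq> {}" by blast
    qed
    finally show ?thesis .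
  qed
  ultimately show ?thesis
    unfolding functional_calculus_def
    by (intro conjI bounded_sym_op exI[of _ "\<lambda>_. [:\<alpha>, \<beta>:]"]) auto
qed

text \<open>Rotating \<open>diag(x, y)\<close> so that its first diagonal entry is \<open>l x + (1 - l) y < m\<close> gives a
  matrix below \<open>diag(m, K)\<close> for large \<open>K\<close>; then compare the first diagonal entries after
  applying \<open>f\<close>.\<close>

lemma operator_monotone_here_weak_concave:
  assumes mono: "operator_monotone_here f" and xy: "0 < x" "x < y"
    and l: "0 < l" "l < 1" and m: "l * x + (1 - l) * y < m"
  shows "l * f x + (1 - l) * f y \<le> f m"
proof -
  \<comment> \<open>These are the entries, up to the sign of \<open>c\<close>, of
    \<open>diag(x, y)\<close> rotated by an angle whose squared cosine is \<open>l\<close>.\<close>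
  define p q where "p = l * x + (1 - l) * y" and "q = (1 - l) * x + l * y"
  define c where "c = sqrt (l * (1 - l)) * (y - x)"
  \<comment> \<open>\<delta> solves \<open>c\<^sup>2 = (m - p) * \<delta>\<close>, so
    \<open>K - q \<ge> \<delta>\<close> gives the determinant condition for the order. The summand
    \<open>m\<close> also forces \<open>m < K\<close>, which allows interpolation at
    \<open>m\<close> and \<open>K\<close>.\<close>
  define \<delta> where "\<delta> = c\<^sup>2 / (m - p)"
  define K where "K = q + \<delta> + m"
  have c2: "c\<^sup>2 = l * (1 - l) * (y - x)\<^sup>2"
    using l by (simp add: c_def power_mult_distrib)
  have pq: "p + q = x + y" "p * q - c\<^sup>2 = x * y"
    unfolding c2 p_def q_def by (simp_all add: power2_eq_square algebra_simps)
  have pos: "0 < p" "0 < q"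
    using xy l by (auto simp: p_def q_def intro!: add_pos_pos)
  have pm: "p < m" using m by (simp add: p_def)
  have \<delta>: "0 \<le> \<delta>" using pm by (simp add: \<delta>_def)
  have K: "m < K" "0 < K" using \<delta> pos pm by (simp_all add: K_def)
  define \<beta> \<alpha> where "\<beta> = (f y - f x) / (y - x)" and "\<alpha> = f x - \<beta> * x"
  define \<beta>' \<alpha>' where "\<beta>' = (f K - f m) / (K - m)" and "\<alpha>' = f m - \<beta>' * m"
  have "\<beta> * (y - x) = f y - f x" using xy by (simp add: \<beta>_def)
  then have fxy: "f x = \<alpha> + \<beta> * x" "f y = \<alpha> + \<beta> * y" by (simp_all add: \<alpha>_def algebra_simps)
  have "\<beta>' * (K - m) = f K - f m" using K by (simp add: \<beta>'_def)
  then have fmK: "f m = \<alpha>' + \<beta>' * m" "f K = \<alpha>' + \<beta>' * K" by (simp_all add: \<alpha>'_def algebra_simps)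
  have "(0 - c)\<^sup>2 \<le> (m - p) * (K - q)"
  proof -
    have "c\<^sup>2 = (m - p) * \<delta>" using pm by (simp add: \<delta>_def)
    also have "\<dots> \<le> (m - p) * (K - q)"
      using pm pos by (intro mult_left_mono) (auto simp: K_def)
    finally show ?thesis by simp
  qed
  then have "op_le (sym_op p c q) (sym_op m 0 K)"
    using pm by (rule op_le_sym_op[rotated])
  moreover have "positive_definite_op (sym_op p c q)"
    using positive_definite_sym_op[OF pq] xy pos by simp
  moreover have "positive_definite_op (sym_op m 0 K)"
    using pm pos K by (intro positive_definite_sym_op[of m K m K]) auto
  moreover have "functional_calculus f (sym_op p c q) (sym_op (\<alpha> + \<beta> * p) (\<beta> * c) (\<alpha> + \<beta> * q))"
    using functional_calculus_sym_op[OF pq, of f] fxy by blast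
  moreover have "functional_calculus f (sym_op m 0 K) (sym_op (\<alpha>' + \<beta>' * m) (\<beta>' * 0) (\<alpha>' + \<beta>' * K))"
    using fmK by (intro functional_calculus_sym_op[of m K m K]) auto
  ultimately have le: "op_le (sym_op (\<alpha> + \<beta> * p) (\<beta> * c) (\<alpha> + \<beta> * q))
      (sym_op (\<alpha>' + \<beta>' * m) (\<beta>' * 0) (\<alpha>' + \<beta>' * K))"
    using mono unfolding operator_monotone_here_def by blast
  define v where "v = (\<lambda>i. if i = a then 1 else 0 :: complex)"
  have v: "v \<in> H" "v a = 1" "v b = 0" using a_neq_b by (auto simp: v_def H_def)
  have "\<alpha> + \<beta> * p \<le> \<alpha>' + \<beta>' * m"
    using le[unfolded op_le_def Re_ip_sym_op, THEN bspec, OF v(1)] by (simp add: v)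
  \<comment> \<open>The affine interpolant maps the convex combination \<open>p\<close> of
    \<open>x\<close> and \<open>y\<close> to the same combination of the values.\<close>
  moreover have "\<alpha> + \<beta> * p = l * f x + (1 - l) * f y"
    unfolding fxy p_def by (simp add: algebra_simps)
  ultimately show ?thesis by (simp add: fmK)
qed

end

text \<open>An infinite index type has two distinct indices, hence a coordinate plane to which the
  monotonicity hypothesis applies.\<close>

lemma operator_monotone_imp_concave:
  assumes mono: "operator_monotone TYPE('i::infinite \<Rightarrow> complex) f"
  shows "concave_on {0<..} f"
proof -
  obtain a :: 'i where True by simp
  obtain b where "b \<noteq> a" using ex_new_if_finite[OF infinite_UNIV, of "{a}"] by auto
  then interpret coordinate_plane a b by unfold_locales simp
  have "operator_monotone_here f"
    using mono complex_hilbert_space_axioms unfolding operator_monotone_def by blast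
  note weak = operator_monotone_here_weak_concave[OF this]
  have main: "l * f x + (1 - l) * f y \<le> f (l * x + (1 - l) * y)"
    if xy: "0 < x" "x < y" and l: "0 < l" "l < 1" for l x y
    \<comment> \<open>Weights \<open>k > l\<close> move the convex combination strictly to the left, which gives room for
      \<open>weak\<close>; letting \<open>k\<close> tend to \<open>l\<close> needs no continuity of \<open>f\<close>.\<close>
  proof (rule tendsto_upperbound)
    show "((\<lambda>k. k * f x + (1 - k) * f y) \<longlongrightarrow> l * f x + (1 - l) * f y) (at_right l)"
      by (intro tendsto_intros)
    show "\<forall>\<^sub>F k in at_right l. k * f x + (1 - k) * f y \<le> f (l * x + (1 - l) * y)"
      using eventually_at_right_real[OF l(2)]
    proof eventually_elim
      case (elim k)
      then have "(k - l) * (y - x) > 0" using xy by simp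
      then show ?case using elim l xy by (intro weak) (auto simp: algebra_simps)
    qed
  qed simp
  show ?thesis
    unfolding concave_on_def
  proof (rule convex_on_linorderI)
    fix t x y :: real assume t: "0 < t" "t < 1" and "x \<in> {0<..}" "y \<in> {0<..}" "x < y"
    then show "- f ((1 - t) *\<^sub>R x + t *\<^sub>R y) \<le> (1 - t) * - f x + t * - f y"
      using main[of x y "1 - t"] by simp
  qed simp
qed

section \<open>Spectral theorem for Hermitian matrices\<close>

lemma mat_adjoint_carrier [simp, intro]:
  "A \<in> carrier_mat n m \<Longrightarrow> mat_adjoint A \<in> carrier_mat m n"
  by (auto simp: mat_adjoint_def)

lemma dim_mat_adjoint [simp]:
  "dim_row (mat_adjoint A) = dim_col A" "dim_col (mat_adjoint A) = dim_row A"
  by (auto simp: mat_adjoint_def)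

lemma row_mat_adjoint:
  "i < dim_col A \<Longrightarrow> row (mat_adjoint A) i = conjugate (col A i)"
  by (auto simp: mat_adjoint_def)

lemma index_mat_adjoint [simp]:
  assumes "i < dim_col A" "j < dim_row A"
  shows "mat_adjoint A $$ (i, j) = conjugate (A $$ (j, i))"
proof -
  have "mat_adjoint A $$ (i, j) = row (mat_adjoint A) i $ j"
    using assms by simp
  also have "\<dots> = conjugate (A $$ (j, i))"
    unfolding row_mat_adjoint[OF assms(1)] using assms by simp
  finally show ?thesis .
qed

lemma mat_adjoint_adjoint [simp]: "mat_adjoint (mat_adjoint A) = A"
  by (rule eq_matI) auto

lemma mat_adjoint_one [simp]: "mat_adjoint (1\<^sub>m n :: complex mat) = 1\<^sub>m n"
  by (rule eq_matI) auto

lemma mat_adjoint_mat_diag: "mat_adjoint (mat_diag n g) = mat_diag n (\<lambda>i. conjugate (g i))"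
  by (rule eq_matI) (auto simp: mat_diag_def)

lemma mat_adjoint_mult:
  fixes A B :: "complex mat"
  assumes "A \<in> carrier_mat n k" "B \<in> carrier_mat k m"
  shows "mat_adjoint (A * B) = mat_adjoint B * mat_adjoint A"
  by (rule eq_matI) (use assms in \<open>auto simp: scalar_prod_def mult.commute\<close>)

lemma mat_trace_comm:
  assumes "A \<in> carrier_mat n k" "B \<in> carrier_mat k n"
  shows "mat_trace (A * B) = mat_trace (B * A)"
proof -
  have "mat_trace (A * B) = (\<Sum>i<n. \<Sum>j<k. A $$ (i, j) * B $$ (j, i))"
    using assms by (simp add: mat_trace_def scalar_prod_def atLeast0LessThan)
  also have "\<dots> = (\<Sum>j<k. \<Sum>i<n. B $$ (j, i) * A $$ (i, j))"
    by (subst sum.swap) (simp add: mult.commute)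
  also have "\<dots> = mat_trace (B * A)"
    using assms by (simp add: mat_trace_def scalar_prod_def atLeast0LessThan)
  finally show ?thesis .
qed

text \<open>Links matrix identities to quadratic forms. \<open>P\<close> may be rectangular, so a
  single vector can be treated as a one-column matrix.\<close>

lemma diag_adjoint_mult_mult:
  assumes P: "P \<in> carrier_mat n m" and M: "M \<in> carrier_mat n n" and i: "i < m"
  shows "(mat_adjoint P * (M * P)) $$ (i, i) = (M *\<^sub>v col P i) \<bullet>c col P i"
proof -
  have "(mat_adjoint P * (M * P)) $$ (i, i) = conjugate (col P i) \<bullet> col (M * P) i"
    using assms by (subst index_mult_mat) (auto simp: row_mat_adjoint)
  also have "col (M * P) i = M *\<^sub>v col P i"
    using assms by (intro col_mult2) auto
  also have "conjugate (col P i) \<bullet> (M *\<^sub>v col P i) = (M *\<^sub>v col P i) \<bullet>c col P i"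
    by (rule comm_scalar_prod[of _ n]) (use assms in auto)
  finally show ?thesis .
qed

section \<open>Unitary matrices and the functional calculus of Hermitian matrices\<close>

lemma unitary_mat_carrier: "unitary_mat n U \<Longrightarrow> U \<in> carrier_mat n n"
  by (simp add: unitary_mat_def)

text \<open>Cancellation in the form that matches products associated to the right.\<close>

lemma unitary_mat_cancel:
  assumes "unitary_mat n U" "X \<in> carrier_mat n m"
  shows "U * (mat_adjoint U * X) = X" "mat_adjoint U * (U * X) = X"
  using assms unfolding unitary_mat_def
  by (auto simp flip: assoc_mult_mat[of _ n n _ n _ m])

lemma unitary_mat_mult:
  assumes U: "unitary_mat n U" and V: "unitary_mat n V"
  shows "unitary_mat n (U * V)"
proof -
  note UV = U[THEN unitary_mat_carrier] V[THEN unitary_mat_carrier]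
  note [simp] = assoc_mult_mat[of _ n n _ n _ n] mat_adjoint_mult[OF UV] UV mult_carrier_mat[of _ n n _ n]
    unitary_mat_cancel[OF U, of _ n] unitary_mat_cancel[OF V, of _ n]
  show ?thesis
    unfolding unitary_mat_def
    using U V by (simp add: unitary_mat_def)
qed

text \<open>The definite description requires independence of the diagonalization. Given two,
  \<open>W = mat_adjoint V * U\<close> intertwines the diagonal matrices, so a nonzero entry
  \<open>W $$ (i, j)\<close> forces \<open>e i = d j\<close>. Hence \<open>W\<close> also
  intertwines the diagonals after applying \<open>f\<close>.\<close>

lemma mat_fun_eq:
  assumes U: "unitary_mat n U"
    and A: "A = U * mat_diag n (\<lambda>i. complex_of_real (d i)) * mat_adjoint U"
  shows "mat_fun f A = U * mat_diag n (\<lambda>i. complex_of_real (f (d i))) * mat_adjoint U"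
proof -
  note cU = unitary_mat_carrier[OF U]
  have n: "dim_row A = n" using cU unfolding A by auto
  show ?thesis
    unfolding mat_fun_def n
  proof (rule the_equality)
    fix M
    assume "\<exists>V e. unitary_mat n V \<and> A = V * mat_diag n (\<lambda>i. complex_of_real (e i)) * mat_adjoint V \<and>
      M = V * mat_diag n (\<lambda>i. complex_of_real (f (e i))) * mat_adjoint V"
    then obtain V e where V: "unitary_mat n V"
      and AV: "A = V * mat_diag n (\<lambda>i. complex_of_real (e i)) * mat_adjoint V"
      and M: "M = V * mat_diag n (\<lambda>i. complex_of_real (f (e i))) * mat_adjoint V"
      by blast
    note cV = unitary_mat_carrier[OF V]
    note [simp] = cU cV assoc_mult_mat[of _ n n _ n _ n] mult_carrier_mat[of _ n n _ n]
      unitary_mat_cancel[OF U, of _ n] unitary_mat_cancel[OF V, of _ n]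
    have U1: "mat_adjoint U * U = 1\<^sub>m n" "U * mat_adjoint U = 1\<^sub>m n"
      using U by (auto simp: unitary_mat_def)
    define W where "W = mat_adjoint V * U"
    have cW [simp]: "W \<in> carrier_mat n n" by (simp add: W_def)
    have "mat_adjoint V * A * U = mat_diag n (\<lambda>i. complex_of_real (e i)) * W"
      unfolding AV W_def by simp
    moreover have "mat_adjoint V * A * U = W * mat_diag n (\<lambda>i. complex_of_real (d i))"
      unfolding A W_def by (simp add: U1 right_mult_one_mat[of _ n n])
    ultimately have eq: "mat_diag n (\<lambda>i. complex_of_real (e i)) * W
        = W * mat_diag n (\<lambda>i. complex_of_real (d i))" by simp
    have ij: "complex_of_real (e i) * W $$ (i, j) = W $$ (i, j) * complex_of_real (d j)"
      if "i < n" "j < n" for i j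
      using arg_cong[OF eq, of "\<lambda>X. X $$ (i, j)"] that
      by (simp add: mat_diag_mult_left[of _ n n] mat_diag_mult_right[of _ n n])
    have feq: "mat_diag n (\<lambda>i. complex_of_real (f (e i))) * W
        = W * mat_diag n (\<lambda>i. complex_of_real (f (d i)))"
    proof (rule eq_matI)
      fix i j
      assume "i < dim_row (W * mat_diag n (\<lambda>i. complex_of_real (f (d i))))"
        "j < dim_col (W * mat_diag n (\<lambda>i. complex_of_real (f (d i))))"
      then have "i < n" "j < n" by (auto simp: mat_diag_def W_def carrier_matD[OF cV])
      moreover have "complex_of_real (f (e i)) * W $$ (i, j) = W $$ (i, j) * complex_of_real (f (d j))"
        using ij[OF \<open>i < n\<close> \<open>j < n\<close>] by (cases "W $$ (i, j) = 0") auto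
      ultimately show "(mat_diag n (\<lambda>i. complex_of_real (f (e i))) * W) $$ (i, j)
          = (W * mat_diag n (\<lambda>i. complex_of_real (f (d i)))) $$ (i, j)"
        by (simp add: mat_diag_mult_left[of _ n n] mat_diag_mult_right[of _ n n])
    qed (auto simp: mat_diag_def carrier_matD[OF cW])
    have "M = V * (mat_diag n (\<lambda>i. complex_of_real (f (e i))) * W) * mat_adjoint U"
      unfolding M W_def by (simp add: U1 right_mult_one_mat[of _ n n])
    also have "\<dots> = U * mat_diag n (\<lambda>i. complex_of_real (f (d i))) * mat_adjoint U"
      unfolding feq by (simp add: W_def)
    finally show "M = U * mat_diag n (\<lambda>i. complex_of_real (f (d i))) * mat_adjoint U" .
  qed (use U A in blast)
qed

text \<open>Gram-Schmidt applied to a basis that starts with \<open>v\<close> keeps \<open>v\<close>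
  in front; scaling the orthogonal vectors to unit length, by the factors \<open>s i\<close>, makes
  the matrix of columns unitary.\<close>

lemma unitary_completion:
  fixes v :: "complex vec"
  assumes v: "v \<in> carrier_vec n" and v0: "v \<noteq> 0\<^sub>v n"
  obtains U k where "unitary_mat n U" "col U 0 = k \<cdot>\<^sub>v v"
proof -
  interpret cof_vec_space n "TYPE(complex)" .
  define ws where "ws = gram_schmidt n (basis_completion v)"
  note b = basis_completion[OF v v0]
  from gram_schmidt_result[OF b(2,4,5) refl, folded ws_def]
  have ws: "set ws \<subseteq> carrier_vec n" "corthogonal ws" "length ws = n"
    by (auto simp: b(6))
  have n: "0 < n" using v v0 by (cases n) auto
  have "basis_completion v = v # tl (basis_completion v)"
    using b(6,7) n by (cases "basis_completion v") auto
  then have "hd ws = v"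
    unfolding ws_def using gram_schmidt_hd[OF v] by metis
  then have ws0: "ws ! 0 = v" using ws(3) n by (metis hd_conv_nth length_0_conv less_numeral_extra(3))
  have cw: "ws ! i \<in> carrier_vec n" if "i < n" for i using ws that by auto
  define s where "s i = complex_of_real (1 / sqrt (Re (ws ! i \<bullet>c ws ! i)))" for i
  define U where "U = mat n n (\<lambda>(k, j). s j * ws ! j $ k)"
  have cU: "U \<in> carrier_mat n n" by (simp add: U_def)
  have ip: "(mat_adjoint U * U) $$ (i, j) = cnj (s i) * s j * (ws ! j \<bullet>c ws ! i)"
    if ij: "i < n" "j < n" for i j
  proof -
    have "(mat_adjoint U * U) $$ (i, j) = (\<Sum>k = 0..<n. cnj (s i * ws ! i $ k) * (s j * ws ! j $ k))"
      using ij cU by (simp add: scalar_prod_def) (simp add: U_def)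
    also have "\<dots> = cnj (s i) * s j * (\<Sum>k = 0..<n. ws ! j $ k * cnj (ws ! i $ k))"
      by (simp add: sum_distrib_left mult_ac)
    also have "(\<Sum>k = 0..<n. ws ! j $ k * cnj (ws ! i $ k)) = ws ! j \<bullet>c ws ! i"
      using cw[OF ij(1)] by (simp add: scalar_prod_def)
    finally show ?thesis .
  qed
  have "mat_adjoint U * U = 1\<^sub>m n"
  proof (rule eq_matI)
    fix i j assume "i < dim_row (1\<^sub>m n)" "j < dim_col (1\<^sub>m n)"
    then have ij: "i < n" "j < n" by auto
    show "(mat_adjoint U * U) $$ (i, j) = 1\<^sub>m n $$ (i, j)"
    proof (cases "i = j")
      case True
      let ?r = "Re (ws ! i \<bullet>c ws ! i)"
      \<comment> \<open>In the order on complex numbers a nonnegative number is real, so the squared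
        norm equals its real part.\<close>
      have "0 \<le> ws ! i \<bullet>c ws ! i" by (rule conjugate_square_ge_0_vec)
      then have r: "0 \<le> ?r" "ws ! i \<bullet>c ws ! i = of_real ?r"
        by (auto simp: less_eq_complex_def complex_eq_iff)
      have "ws ! i \<bullet>c ws ! i \<noteq> 0"
        using corthogonalD[OF ws(2), of i i] ij ws(3) by auto
      then have "?r \<noteq> 0" using r(2) by auto
      then have "1 / sqrt ?r * (1 / sqrt ?r) * ?r = 1" using r(1) by simp
      then have "cnj (s i) * s i * (ws ! i \<bullet>c ws ! i) = 1"
        by (subst r(2)) (simp only: s_def complex_cnj_complex_of_real flip: of_real_mult, simp)
      then show ?thesis using ip[OF ij] True ij by simp
    next
      case False
      then have "ws ! j \<bullet>c ws ! i = 0"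
        using corthogonalD[OF ws(2), of j i] ij ws(3) by auto
      then show ?thesis using ip[OF ij] False ij by simp
    qed
  qed (use cU in auto)
  then have "unitary_mat n U"
    unfolding unitary_mat_def using cU mat_mult_left_right_inverse[OF mat_adjoint_carrier[OF cU] cU]
    by blast
  moreover have "col U 0 = s 0 \<cdot>\<^sub>v v"
    by (rule eq_vecI) (use n v ws0 in \<open>auto simp: U_def\<close>)
  ultimately show thesis by (rule that)
qed

text \<open>Induction on the dimension: in an orthonormal basis starting with an eigenvector, the
  first column of the matrix is zero below its head, by Hermitian symmetry so is the first row
  beyond it, and the remaining block is Hermitian of smaller size.\<close>

theorem hermitian_mat_spectral:
  assumes "hermitian_mat n A"
  obtains U d where "unitary_mat n U"
    "A = U * mat_diag n (\<lambda>i. complex_of_real (d i)) * mat_adjoint U"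
proof -
  have "\<exists>U d. unitary_mat n U \<and> A = U * mat_diag n (\<lambda>i. complex_of_real (d i)) * mat_adjoint U"
    using assms
  proof (induction n arbitrary: A)
    case 0
    have "unitary_mat 0 (1\<^sub>m 0)" by (simp add: unitary_mat_def)
    moreover have "A = 1\<^sub>m 0 * mat_diag 0 (\<lambda>i. complex_of_real 0) * mat_adjoint (1\<^sub>m 0)"
      by (rule eq_matI) (use 0 in \<open>auto simp: hermitian_mat_def\<close>)
    ultimately show ?case by (intro exI conjI)
  next
    case (Suc m)
    let ?n = "Suc m"
    have A: "A \<in> carrier_mat ?n ?n" and herm: "mat_adjoint A = A"
      using Suc.prems by (auto simp: hermitian_mat_def)
    \<comment> \<open>Over the complex numbers the characteristic polynomial splits into
      \<open>Suc m\<close> linear factors, so it has a root.\<close>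
    obtain as where as: "char_poly A = (\<Prod>a\<leftarrow>as. [:- a, 1:])" "length as = ?n"
      using char_poly_factorized[OF A] by blast
    then obtain e es where "as = e # es" by (cases as) auto
    then have "eigenvalue A e"
      unfolding eigenvalue_root_char_poly[OF A] as by simp
    then obtain v where v: "v \<in> carrier_vec ?n" "v \<noteq> 0\<^sub>v ?n" "A *\<^sub>v v = e \<cdot>\<^sub>v v"
      using A by (auto simp: eigenvalue_def eigenvector_def)
    obtain U k where U: "unitary_mat ?n U" and U0: "col U 0 = k \<cdot>\<^sub>v v"
      by (rule unitary_completion[OF v(1,2)])
    note cU = unitary_mat_carrier[OF U]
    have U1: "mat_adjoint U * U = 1\<^sub>m ?n" "U * mat_adjoint U = 1\<^sub>m ?n"
      using U by (auto simp: unitary_mat_def)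
    note [simp] = cU A assoc_mult_mat[of _ ?n ?n _ ?n _ ?n] mult_carrier_mat[of _ ?n ?n _ ?n]
      unitary_mat_cancel[OF U, of _ ?n] mat_adjoint_mult[of _ ?n ?n _ ?n]
    define B where "B = mat_adjoint U * (A * U)"
    have B: "B \<in> carrier_mat ?n ?n" by (simp add: B_def)
    have hB: "mat_adjoint B = B" by (simp add: B_def herm)
    have AB: "A = U * B * mat_adjoint U"
      by (simp add: B_def U1 right_mult_one_mat[of _ ?n ?n])
    have Bi0: "B $$ (i, 0) = (if i = 0 then e else 0)" if i: "i < ?n" for i
    proof -
      have "col (A * U) 0 = A *\<^sub>v col U 0"
        using A cU by (intro col_mult2[of _ ?n ?n _ ?n]) auto
      also have "\<dots> = e \<cdot>\<^sub>v col U 0"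
        using v by (simp add: U0 mult_mat_vec[OF A] smult_smult_assoc mult.commute)
      finally have "B $$ (i, 0) = row (mat_adjoint U) i \<bullet> (e \<cdot>\<^sub>v col U 0)"
        unfolding B_def using i carrier_matD[OF cU] by (subst index_mult_mat) simp_all
      also have "\<dots> = e * (row (mat_adjoint U) i \<bullet> col U 0)"
        using carrier_matD[OF cU] i
        by (intro scalar_prod_smult_distrib[of _ ?n]) (auto intro!: carrier_vecI)
      also have "row (mat_adjoint U) i \<bullet> col U 0 = (mat_adjoint U * U) $$ (i, 0)"
        using i carrier_matD[OF cU] by (subst index_mult_mat) simp_all
      also have "\<dots> = (if i = 0 then 1 else 0)"
        unfolding U1 using i by simp
      finally show ?thesis by simp
    qed
    have Bsym: "B $$ (i, j) = cnj (B $$ (j, i))" if "i < ?n" "j < ?n" for i j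
      using arg_cong[OF hB, of "\<lambda>X. X $$ (i, j)"] B that by simp
    \<comment> \<open>The eigenvalue is a diagonal entry of the Hermitian matrix \<open>B\<close>,
      hence real.\<close>
    have e: "e = complex_of_real (Re e)"
      using Bsym[of 0 0] Bi0[of 0] by (simp add: complex_eq_iff)
    have B0i: "B $$ (0, i) = (if i = 0 then e else 0)" if "i < ?n" for i
      using Bsym[of 0 i] Bi0[of i] e that by (auto simp: complex_eq_iff)
    define C where "C = mat m m (\<lambda>(i, j). B $$ (Suc i, Suc j))"
    have C: "C \<in> carrier_mat m m" by (simp add: C_def)
    have "hermitian_mat m C"
      unfolding hermitian_mat_def
    proof (intro conjI eq_matI)
      show "mat_adjoint C $$ (i, j) = C $$ (i, j)" if "i < dim_row C" "j < dim_col C" for i j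
        using that Bsym[of "Suc i" "Suc j"] by (simp add: C_def)
    qed (auto simp: C_def)
    from Suc.IH[OF this] obtain V d where V: "unitary_mat m V"
      and CV: "C = V * mat_diag m (\<lambda>i. complex_of_real (d i)) * mat_adjoint V" by blast
    note cV = unitary_mat_carrier[OF V]
    let ?Z = "0\<^sub>m 1 m :: complex mat" and ?Z' = "0\<^sub>m m 1 :: complex mat"
    \<comment> \<open>The diagonalization of the block is extended by \<open>1\<close> in the
      corner, and its eigenvalues by \<open>e\<close> in front.\<close>
    define W where "W = four_block_mat (1\<^sub>m 1) ?Z ?Z' V"
    define d' where "d' i = (case i of 0 \<Rightarrow> Re e | Suc i \<Rightarrow> d i)" for i
    let ?D = "mat_diag ?n (\<lambda>i. complex_of_real (d' i))"
    have cW [simp]: "W \<in> carrier_mat ?n ?n" using cV by (auto simp: W_def)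
    have Wa: "mat_adjoint W = four_block_mat (1\<^sub>m 1) ?Z ?Z' (mat_adjoint V)"
      by (rule eq_matI) (use cV in \<open>auto simp: W_def\<close>)
    have D: "?D = four_block_mat (mat 1 1 (\<lambda>_. e)) ?Z ?Z' (mat_diag m (\<lambda>i. complex_of_real (d i)))"
      by (rule eq_matI) (use e in \<open>auto simp: mat_diag_def d'_def split: nat.splits\<close>)
    have block: "four_block_mat X ?Z ?Z' Y * four_block_mat X' ?Z ?Z' Y'
        = four_block_mat (X * X') ?Z ?Z' (Y * Y')"
      if "X \<in> carrier_mat 1 1" "X' \<in> carrier_mat 1 1" "Y \<in> carrier_mat m m" "Y' \<in> carrier_mat m m"
      for X X' Y Y' :: "complex mat"
      using that by (subst mult_four_block_mat[of _ 1 1 _ m _ m _ _ 1 _ m])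
        (auto simp: left_add_zero_mat[of _ _ _] right_add_zero_mat[of _ _ _])
    have "unitary_mat ?n W"
      unfolding unitary_mat_def Wa
      using V cV cW by (simp add: W_def block plus_1_eq_Suc unitary_mat_def del: One_nat_def)
    then have UW: "unitary_mat ?n (U * W)" by (rule unitary_mat_mult[OF U])
    have "W * ?D * mat_adjoint W = four_block_mat (mat 1 1 (\<lambda>_. e)) ?Z ?Z' C"
      unfolding Wa D CV unfolding W_def using cV by (simp add: block del: assoc_mult_mat One_nat_def)
    also have "\<dots> = B"
      by (rule eq_matI)
        (use B Bi0 B0i in \<open>auto simp: C_def gr0_conv_Suc split: if_splits\<close>)
    finally have B_eq: "W * ?D * mat_adjoint W = B" .
    have "A = U * W * ?D * mat_adjoint (U * W)"
      unfolding AB B_eq[symmetric] by simp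
    with UW show ?case by blast
  qed
  then show thesis using that by blast
qed

section \<open>Expectations of the mean\<close>

text \<open>Each \<open>d i\<close> is the quadratic form of \<open>A\<close> at column
  \<open>i\<close> of \<open>U\<close>, which is nonzero because \<open>U\<close> is
  unitary.\<close>

lemma positive_definite_mat_spectral:
  assumes "positive_definite_mat n A"
  obtains U d where "unitary_mat n U" "\<And>i. i < n \<Longrightarrow> 0 < d i"
    "A = U * mat_diag n (\<lambda>i. complex_of_real (d i)) * mat_adjoint U"
proof -
  have herm: "hermitian_mat n A" using assms by (simp add: positive_definite_mat_def)
  obtain U d where U: "unitary_mat n U"
    and A: "A = U * mat_diag n (\<lambda>i. complex_of_real (d i)) * mat_adjoint U"
    using hermitian_mat_spectral[OF herm] by blast
  note cU = unitary_mat_carrier[OF U]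
  have U1: "mat_adjoint U * U = 1\<^sub>m n" using U by (simp add: unitary_mat_def)
  have cA: "A \<in> carrier_mat n n" using herm by (simp add: hermitian_mat_def)
  note [simp] = cU assoc_mult_mat[of _ n n _ n _ n] mult_carrier_mat[of _ n n _ n]
    unitary_mat_cancel[OF U, of _ n]
  have D: "mat_adjoint U * (A * U) = mat_diag n (\<lambda>i. complex_of_real (d i))"
    unfolding A by (simp add: U1 right_mult_one_mat[of _ n n])
  have "0 < d i" if i: "i < n" for i
  proof -
    have "(1\<^sub>m n :: complex mat) $$ (i, i) = (mat_adjoint U * U) $$ (i, i)" by (simp add: U1)
    also have "\<dots> = row (mat_adjoint U) i \<bullet> col U i"
      using i carrier_matD[OF cU] by (subst index_mult_mat) simp_all
    finally have "row (mat_adjoint U) i \<bullet> col U i = 1" using i by simp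
    moreover have "row (mat_adjoint U) i \<bullet> 0\<^sub>v n = 0"
      using carrier_matD[OF cU] by (auto intro!: scalar_prod_right_zero carrier_vecI)
    ultimately have "col U i \<noteq> 0\<^sub>v n" by auto
    moreover have "col U i \<in> carrier_vec n"
      using i carrier_matD[OF cU] by (auto intro!: carrier_vecI)
    ultimately have "0 < Re ((A *\<^sub>v col U i) \<bullet>c col U i)"
      using assms unfolding positive_definite_mat_def by blast
    also have "(A *\<^sub>v col U i) \<bullet>c col U i = d i"
      unfolding diag_adjoint_mult_mult[OF cU cA i, symmetric] D using i by (simp add: mat_diag_def)
    finally show ?thesis by simp
  qed
  with U A show thesis by (intro that) auto
qed

text \<open>The new form at \<open>v\<close> is that of \<open>B\<close> at
  \<open>S *\<^sub>v v\<close>, and the left inverse \<open>S'\<close> keeps this vector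
  nonzero.\<close>

lemma positive_definite_mat_congruence:
  assumes B: "positive_definite_mat n B"
    and S: "S \<in> carrier_mat n n" "S' \<in> carrier_mat n n" "S' * S = 1\<^sub>m n"
  shows "positive_definite_mat n (mat_adjoint S * B * S)"
  unfolding positive_definite_mat_def
proof (intro conjI ballI impI)
  have cB: "B \<in> carrier_mat n n" and hB: "mat_adjoint B = B"
    using B by (auto simp: positive_definite_mat_def hermitian_mat_def)
  note [simp] = S(1,2) cB assoc_mult_mat[of _ n n _ n _ n] mult_carrier_mat[of _ n n _ n]
    mat_adjoint_mult[of _ n n _ n]
  show "hermitian_mat n (mat_adjoint S * B * S)"
    by (simp add: hermitian_mat_def hB)
  fix v :: "complex vec"
  assume v: "v \<in> carrier_vec n" "v \<noteq> 0\<^sub>v n"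
  have cSv: "S *\<^sub>v v \<in> carrier_vec n" by (rule mult_mat_vec_carrier[OF S(1) v(1)])
  have "S *\<^sub>v v \<noteq> 0\<^sub>v n"
  proof
    assume 0: "S *\<^sub>v v = 0\<^sub>v n"
    have "v = (S' * S) *\<^sub>v v" using v S by simp
    also have "\<dots> = S' *\<^sub>v (S *\<^sub>v v)" by (rule assoc_mult_mat_vec[of _ n n _ n]) (use v in auto)
    also have "\<dots> = 0\<^sub>v n" unfolding 0
      by (rule eq_vecI) (use carrier_matD[OF S(2)] in \<open>auto intro!: scalar_prod_right_zero carrier_vecI\<close>)
    finally show False using v by simp
  qed
  with B cSv have pos: "0 < Re ((B *\<^sub>v (S *\<^sub>v v)) \<bullet>c (S *\<^sub>v v))"
    unfolding positive_definite_mat_def by blast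
  \<comment> \<open>Viewing \<open>v\<close> as a one-column matrix turns moving \<open>S\<close>
    across the inner product into associativity.\<close>
  define M where "M = mat_of_cols n [v]"
  have M: "M \<in> carrier_mat n 1" "col M 0 = v"
    using v by (auto simp: M_def)
  have "((mat_adjoint S * B * S) *\<^sub>v v) \<bullet>c v = (mat_adjoint M * ((mat_adjoint S * B * S) * M)) $$ (0, 0)"
    using diag_adjoint_mult_mult[OF M(1), of "mat_adjoint S * B * S" 0] M(2) by simp
  also have "mat_adjoint M * ((mat_adjoint S * B * S) * M) = mat_adjoint (S * M) * (B * (S * M))"
    using M(1) by (simp add: mat_adjoint_mult[of _ n n _ 1] mult_carrier_mat[of _ n n _ 1]
        mult_carrier_mat[of _ 1 n _ n] assoc_mult_mat[of _ n n _ n _ 1] assoc_mult_mat[of _ 1 n _ n _ n] assoc_mult_mat[of _ 1 n _ n _ 1]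
        del: One_nat_def)
  also have "\<dots> $$ (0, 0) = (B *\<^sub>v col (S * M) 0) \<bullet>c col (S * M) 0"
    by (intro diag_adjoint_mult_mult[of _ n 1] mult_carrier_mat[OF S(1) M(1)]) simp_all
  also have "col (S * M) 0 = S *\<^sub>v v"
    using M col_mult2[OF S(1) M(1), of 0] by simp
  finally have "((mat_adjoint S * B * S) *\<^sub>v v) \<bullet>c v = (B *\<^sub>v (S *\<^sub>v v)) \<bullet>c (S *\<^sub>v v)" .
  with pos show "0 < Re (((mat_adjoint S * B * S) *\<^sub>v v) \<bullet>c v)" by simp
qed

text \<open>By cyclicity of the trace the weights are the diagonal entries of
  \<open>mat_adjoint P * \<rho> * P\<close>. They do not depend on \<open>g\<close>, so one choice
  serves several expectations.\<close>

lemma expectation_congruence_diag: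
  assumes r: "positive_semidefinite_mat n \<rho>" and P: "P \<in> carrier_mat n n"
  obtains w where "\<And>i. i < n \<Longrightarrow> 0 \<le> w i"
    "\<And>g. expectation \<rho> (P * mat_diag n (\<lambda>i. complex_of_real (g i)) * mat_adjoint P) = (\<Sum>i<n. w i * g i)"
proof
  have cr: "\<rho> \<in> carrier_mat n n"
    using r by (simp add: positive_semidefinite_mat_def hermitian_mat_def)
  define Q where "Q = mat_adjoint P * (\<rho> * P)"
  define w where "w i = Re (Q $$ (i, i))" for i
  have cQ: "Q \<in> carrier_mat n n" using P cr by (auto simp: Q_def)
  show "0 \<le> w i" if i: "i < n" for i
  proof -
    have "col P i \<in> carrier_vec n" using carrier_matD[OF P] by (auto intro!: carrier_vecI)
    then show ?thesis
      using r unfolding w_def Q_def diag_adjoint_mult_mult[OF P cr i] positive_semidefinite_mat_def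
      by blast
  qed
  show "expectation \<rho> (P * mat_diag n (\<lambda>i. complex_of_real (g i)) * mat_adjoint P) = (\<Sum>i<n. w i * g i)" for g
  proof -
    let ?D = "mat_diag n (\<lambda>i. complex_of_real (g i))"
    note [simp] = P cr assoc_mult_mat[of _ n n _ n _ n] mult_carrier_mat[of _ n n _ n]
    have "mat_trace (\<rho> * (P * ?D * mat_adjoint P)) = mat_trace ((\<rho> * P * ?D) * mat_adjoint P)"
      by simp
    also have "\<dots> = mat_trace (mat_adjoint P * (\<rho> * P * ?D))"
      by (rule mat_trace_comm[of _ n n]) simp_all
    also have "\<dots> = mat_trace (Q * ?D)" by (simp add: Q_def)
    also have "\<dots> = (\<Sum>i<n. Q $$ (i, i) * g i)"
      by (simp add: mat_diag_mult_right[OF cQ] mat_trace_def)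
    finally show ?thesis by (simp add: expectation_def w_def)
  qed
qed

text \<open>The constant diagonal \<open>1\<close> in the formula for \<open>A\<close> gives all
  three matrices the form handled by \<open>expectation_congruence_diag\<close>.\<close>

lemma matrix_mean_simultaneous_congruence:
  assumes A: "positive_definite_mat n A" and B: "positive_definite_mat n B"
  obtains P e where "P \<in> carrier_mat n n" "\<And>i. i < n \<Longrightarrow> 0 < e i"
    "A = P * mat_diag n (\<lambda>i. complex_of_real 1) * mat_adjoint P"
    "B = P * mat_diag n (\<lambda>i. complex_of_real (e i)) * mat_adjoint P"
    "matrix_mean f A B = P * mat_diag n (\<lambda>i. complex_of_real (f (e i))) * mat_adjoint P"
proof -
  obtain U d where U: "unitary_mat n U" and d: "\<And>i. i < n \<Longrightarrow> 0 < d i"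
    and AU: "A = U * mat_diag n (\<lambda>i. complex_of_real (d i)) * mat_adjoint U"
    using positive_definite_mat_spectral[OF A] by blast
  note cU = unitary_mat_carrier[OF U]
  have U1: "U * mat_adjoint U = 1\<^sub>m n" using U by (simp add: unitary_mat_def)
  have cB: "B \<in> carrier_mat n n" using B by (simp add: positive_definite_mat_def hermitian_mat_def)
  \<comment> \<open>\<open>F g\<close> is the matrix \<open>g(A)\<close>; using the same
    \<open>U\<close> for every \<open>g\<close> makes products of such matrices pointwise.\<close>
  define F where "F g = U * mat_diag n (\<lambda>i. complex_of_real (g (d i))) * mat_adjoint U" for g
  have cF [simp]: "F g \<in> carrier_mat n n" for g using cU by (auto simp: F_def)
  note [simp] = cU cB assoc_mult_mat[of _ n n _ n _ n] mult_carrier_mat[of _ n n _ n]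
    unitary_mat_cancel[OF U, of _ n] mat_adjoint_mult[of _ n n _ n]
  have Fa: "mat_adjoint (F g) = F g" for g
    by (simp add: F_def mat_adjoint_mat_diag)
  \<comment> \<open>Restricting to \<open>0 < t\<close> covers every \<open>d i\<close>, and is
    needed for \<open>t powr (1/2) * t powr (-1/2) = 1\<close>, which fails at
    \<open>0\<close>.\<close>
  have FF: "F g * F h = F k" if "\<And>t. 0 < t \<Longrightarrow> g t * h t = k t" for g h k
  proof -
    have "mat_diag n (\<lambda>i. complex_of_real (g (d i))) * mat_diag n (\<lambda>i. complex_of_real (h (d i)))
        = mat_diag n (\<lambda>i. complex_of_real (k (d i)))"
      unfolding mat_diag_diag using d that by (intro eq_matI) (auto simp: mat_diag_def simp flip: of_real_mult)
    moreover have "F g * F h = U * (mat_diag n (\<lambda>i. complex_of_real (g (d i)))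
        * mat_diag n (\<lambda>i. complex_of_real (h (d i)))) * mat_adjoint U"
      by (simp add: F_def del: mat_diag_diag)
    ultimately show ?thesis by (simp only: F_def)
  qed
  define R where "R = F (\<lambda>t. t powr (1/2))"
  define S where "S = F (\<lambda>t. t powr (-1/2))"
  have cRS [simp]: "R \<in> carrier_mat n n" "S \<in> carrier_mat n n" by (auto simp: R_def S_def)
  have adj: "mat_adjoint R = R" "mat_adjoint S = S" by (simp_all add: R_def S_def Fa)
  have F1: "F (\<lambda>_. 1) = 1\<^sub>m n" using U1 by (simp add: F_def left_mult_one_mat[of _ n n])
  have RR: "R * R = A"
    unfolding R_def using FF[of "\<lambda>t. t powr (1/2)" "\<lambda>t. t powr (1/2)" "\<lambda>t. t"]
    by (simp add: AU F_def flip: powr_add)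
  have RS: "R * S = 1\<^sub>m n" "S * R = 1\<^sub>m n"
    unfolding R_def S_def F1[symmetric] by (rule FF; simp flip: powr_add)+
  have RS_cancel [simp]: "R * (S * X) = X" "S * (R * X) = X" if "X \<in> carrier_mat n n" for X
    using that RS by (simp_all flip: assoc_mult_mat[of _ n n _ n _ n])
  have "positive_definite_mat n (S * B * S)"
    using positive_definite_mat_congruence[OF B cRS(2,1) RS(1)] by (simp add: adj)
  then obtain V e where V: "unitary_mat n V" and e: "\<And>i. i < n \<Longrightarrow> 0 < e i"
    and SBS: "S * B * S = V * mat_diag n (\<lambda>i. complex_of_real (e i)) * mat_adjoint V"
    using positive_definite_mat_spectral by blast
  note cV [simp] = unitary_mat_carrier[OF V]
  have V1: "V * mat_adjoint V = 1\<^sub>m n" using V by (simp add: unitary_mat_def)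
  define P where "P = R * V"
  have Pa: "mat_adjoint P = mat_adjoint V * R" by (simp add: P_def adj)
  show thesis
  proof (rule that[of P e])
    show "P \<in> carrier_mat n n" by (simp add: P_def)
    have "P * mat_diag n (\<lambda>i. complex_of_real 1) * mat_adjoint P = P * mat_adjoint P"
      by (simp add: P_def right_mult_one_mat[of _ n n])
    also have "\<dots> = A"
      unfolding Pa by (simp add: P_def RR unitary_mat_cancel[OF V, of _ n])
    finally show "A = P * mat_diag n (\<lambda>i. complex_of_real 1) * mat_adjoint P" by simp
    have "P * mat_diag n (\<lambda>i. complex_of_real (e i)) * mat_adjoint P = R * (S * B * S) * R"
      unfolding Pa SBS by (simp add: P_def)
    also have "\<dots> = B" by (simp add: RS right_mult_one_mat[of _ n n])
    finally show "B = P * mat_diag n (\<lambda>i. complex_of_real (e i)) * mat_adjoint P" by simp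
    have "matrix_mean f A B = R * mat_fun f (S * B * S) * R"
      unfolding matrix_mean_def Let_def mat_fun_eq[OF U AU] R_def S_def F_def ..
    also have "\<dots> = P * mat_diag n (\<lambda>i. complex_of_real (f (e i))) * mat_adjoint P"
      unfolding mat_fun_eq[OF V SBS] Pa by (simp add: P_def)
    finally show "matrix_mean f A B = \<dots>" .
  qed (rule e)
qed

text \<open>If all weights vanish, both sides are \<open>0\<close> whatever the value of \<open>f\<close> at the junk point
  \<open>inverse 0 * 0 = 0\<close>.\<close>

lemma concave_on_perspective_sum:
  fixes f :: "real \<Rightarrow> real"
  assumes f: "concave_on C f" and "finite I"
    and w: "\<And>i. i \<in> I \<Longrightarrow> 0 \<le> w i" and x: "\<And>i. i \<in> I \<Longrightarrow> x i \<in> C"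
  shows "(\<Sum>i\<in>I. w i * f (x i)) \<le> (\<Sum>i\<in>I. w i) * f (inverse (\<Sum>i\<in>I. w i) * (\<Sum>i\<in>I. w i * x i))"
proof (cases "(\<Sum>i\<in>I. w i) = 0")
  case True
  then have "w i = 0" if "i \<in> I" for i
    using that sum_nonneg_eq_0_iff[of I w] assms by auto
  then show ?thesis by simp
next
  case False
  define a where "a = (\<Sum>i\<in>I. w i)"
  have a: "0 < a" using False sum_nonneg[of I w] w by (simp add: a_def order_less_le)
  \<comment> \<open>Dividing by the total weight \<open>a\<close> produces the weights of sum
    \<open>1\<close> that Jensen's inequality requires.\<close>
  have "(\<Sum>i\<in>I. (w i / a) * f (x i)) \<le> f (\<Sum>i\<in>I. (w i / a) *\<^sub>R x i)"
    using a False w by (intro concave_on_sum[OF \<open>finite I\<close> _ f] x)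
      (auto simp: a_def simp flip: sum_divide_distrib)
  then have "a * (\<Sum>i\<in>I. (w i / a) * f (x i)) \<le> a * f (\<Sum>i\<in>I. (w i / a) *\<^sub>R x i)"
    using a by (intro mult_left_mono) auto
  also have "a * (\<Sum>i\<in>I. (w i / a) * f (x i)) = (\<Sum>i\<in>I. w i * f (x i))"
    using a by (simp add: sum_distrib_left)
  also have "(\<Sum>i\<in>I. (w i / a) *\<^sub>R x i) = inverse a * (\<Sum>i\<in>I. w i * x i)"
    by (simp add: sum_distrib_left field_simps)
  finally show ?thesis by (simp add: a_def)
qed

theorem theorem7p1:
  fixes f :: "real \<Rightarrow> real"
    and n :: nat
    and A B \<rho> :: "complex mat"
  assumes "f \<in> F_op TYPE('i::infinite \<Rightarrow> complex)"
    and "n \<ge> 1"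
    and "positive_definite_mat n A"
    and "positive_definite_mat n B"
    and "density_mat n \<rho>"
  shows "expectation \<rho> (matrix_mean f A B)
           \<le> scalar_mean f (expectation \<rho> A) (expectation \<rho> B)"
proof -
  have f: "concave_on {0<..} f"
    using assms(1) by (intro operator_monotone_imp_concave[where 'i = 'i]) (simp add: F_op_def)
  obtain P e where P: "P \<in> carrier_mat n n" and e: "\<And>i. i < n \<Longrightarrow> 0 < e i"
    and A: "A = P * mat_diag n (\<lambda>i. complex_of_real 1) * mat_adjoint P"
    and B: "B = P * mat_diag n (\<lambda>i. complex_of_real (e i)) * mat_adjoint P"
    and M: "matrix_mean f A B = P * mat_diag n (\<lambda>i. complex_of_real (f (e i))) * mat_adjoint P"
    using matrix_mean_simultaneous_congruence[OF assms(3,4), of f] by blast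
  have "positive_semidefinite_mat n \<rho>" using assms(5) by (simp add: density_mat_def)
  then obtain w where w: "\<And>i. i < n \<Longrightarrow> 0 \<le> w i"
    and E: "\<And>g. expectation \<rho> (P * mat_diag n (\<lambda>i. complex_of_real (g i)) * mat_adjoint P)
      = (\<Sum>i<n. w i * g i)"
    using expectation_congruence_diag[OF _ P] by blast
  have "(\<Sum>i<n. w i * f (e i))
      \<le> (\<Sum>i<n. w i) * f (inverse (\<Sum>i<n. w i) * (\<Sum>i<n. w i * e i))"
    using w e by (intro concave_on_perspective_sum[OF f]) auto
  moreover have "expectation \<rho> (matrix_mean f A B) = (\<Sum>i<n. w i * f (e i))"
    unfolding M by (rule E)
  moreover have "expectation \<rho> A = (\<Sum>i<n. w i)"
    unfolding A E by simp
  moreover have "expectation \<rho> B = (\<Sum>i<n. w i * e i)"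
    unfolding B by (rule E)
  ultimately show ?thesis by (simp add: scalar_mean_def)
qed

end
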